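(* Let $d,n\ge1$ and let $\mathbf{Q}=(Q_1,\dots,Q_n)$ be an $n$-tuple of real quadratic forms in $d$ variables. There is a constant $C$ depending only on $\mathbf{Q}$ such that $$|\widetilde E^{\mathbf{Q}}1(x)|\le C(1+|x|)^{-\frac{\mathfrak{d}_{d,1}(\mathbf{Q})}{2}},\qquad x\in\mathbb{R}^{d+n}.$$ Moreover this bound is optimal: for no $\gamma>\frac{\mathfrak{d}_{d,1}(\mathbf{Q})}{2}$ does there exist a constant $C$ with $|\widetilde E^{\mathbf{Q}}1(x)|\le C(1+|x|)^{-\gamma}$ for all $x\in\mathbb{R}^{d+n}$.
   Context: $\widetilde E^{\mathbf{Q}}f(x)=\int_{\mathbb{R}^d}e^{ix\cdot(\xi,\mathbf{Q}(\xi))}f(\xi)e^{-|\xi|^2/2}\,d\xi$ for $x\in\mathbb{R}^{d+n}$, so $\widetilde E^{\mathbf{Q}}1(x)=\int_{\mathbb{R}^d}e^{ix\cdot(\xi,\mathbf{Q}(\xi))}e^{-|\xi|^2/2}d\xi$. $\mathfrak{d}_{d,1}(\mathbf{Q})=\inf_{M\in\mathrm{GL}(d,\mathbb{R})}\inf_{N\in\mathbb{R}^{n\times1},\,N\ne0}\mathrm{NV}((\mathbf{Q}\circ M)\cdot N)$, where $\mathrm{NV}$ of a quadratic form in $d$ variables is the number of indices $i\in\{1,\dots,d\}$ such that its partial derivative $\partial_{\xi_i}$ is not identically zero. *)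

theory Defs
  imports "HOL-Analysis.Analysis"
begin

text \<open>The space of frequencies is \<open>real ^ 'd\<close>, and an \<open>n\<close>-tuple of forms is a map into
  \<open>real ^ 'n\<close>; index types are finite and nonempty, so \<open>d, n \<ge> 1\<close> holds automatically.\<close>

definition quadratic_form :: "(real ^ 'd \<Rightarrow> real) \<Rightarrow> bool" where
  "quadratic_form q \<longleftrightarrow>
     (\<exists>A :: real ^ 'd ^ 'd. \<forall>\<xi>. q \<xi> = (\<Sum>i\<in>UNIV. \<Sum>j\<in>UNIV. A $ i $ j * \<xi> $ i * \<xi> $ j))"

definition partial_deriv :: "'d \<Rightarrow> (real ^ 'd \<Rightarrow> real) \<Rightarrow> real ^ 'd \<Rightarrow> real" where
  "partial_deriv i q \<xi> = deriv (\<lambda>t. q (\<xi> + t *\<^sub>R axis i 1)) 0"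

definition NV :: "(real ^ 'd \<Rightarrow> real) \<Rightarrow> nat" where
  "NV q = card {i. \<exists>\<xi>. partial_deriv i q \<xi> \<noteq> 0}"

text \<open>A nonzero \<open>n \<times> 1\<close> matrix \<open>N\<close> is a nonzero vector of \<open>real ^ 'n\<close>, and \<open>(Q \<circ> M) \<cdot> N\<close> is then
  the single form below.  The infimum is taken in \<open>nat\<close>, over a nonempty set.\<close>

definition d_d1 :: "(real ^ 'd \<Rightarrow> real ^ 'n) \<Rightarrow> nat" where
  "d_d1 Q = (INF M\<in>{M :: real ^ 'd ^ 'd. invertible M}. INF N\<in>{N :: real ^ 'n. N \<noteq> 0}.
     NV (\<lambda>\<xi>. Q (M *v \<xi>) \<bullet> N))"

text \<open>\<open>\<real>\<^sup>d\<^sup>+\<^sup>n\<close> is the product \<open>(real ^ 'd) \<times> (real ^ 'n)\<close>, whose library norm and inner product are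
  the Euclidean ones.\<close>

definition ext_op ::
  "(real ^ 'd \<Rightarrow> real ^ 'n) \<Rightarrow> (real ^ 'd \<Rightarrow> complex) \<Rightarrow> (real ^ 'd) \<times> (real ^ 'n) \<Rightarrow> complex" where
  "ext_op Q f x =
     (LINT \<xi>|lborel. exp (\<i> * of_real (x \<bullet> (\<xi>, Q \<xi>))) * f \<xi> * of_real (exp (- (norm \<xi>)\<^sup>2 / 2)))"

end

theory Submission
  imports Defs "HOL-Probability.Characteristic_Functions"
begin

text \<open>
  Write \<open>x = (u, v)\<close> and \<open>Q \<xi> \<bullet> v = \<xi> \<bullet> (A\<^sub>v *v \<xi>)\<close> with \<open>A\<^sub>v\<close> symmetric and linear in \<open>v\<close>.  An
  orthogonal change of variables \<open>P\<close> diagonalizes \<open>A\<^sub>v\<close>, with eigenvalues \<open>l i\<close>, and preserves both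
  Lebesgue measure and the Gaussian weight.  The integral then splits into one-dimensional Gaussian
  integrals, whose moduli are explicit (\<open>norm_integral_chirp\<close>).  With \<open>a = transpose P *v u\<close> this gives,
  up to a constant factor (\<open>norm_ext_op\<close>), the fourth power of the modulus of the extension of \<open>1\<close> as
  the product over \<open>i\<close> of \<open>exp (- 2 (a $ i)\<^sup>2 / (1 + 4 (l i)\<^sup>2)) / (1 + 4 (l i)\<^sup>2)\<close>.

  On the other side, \<open>NV\<close> of a quadratic form is the number of nonzero columns of its symmetric matrix,
  so minimizing it over linear changes of variables gives the rank.  Hence \<open>m = d_d1 Q\<close> is the least rank
  of \<open>A\<^sub>v\<close> over \<open>v \<noteq> 0\<close>, the number of nonzero eigenvalues (\<open>d_d1_le_rank\<close>, \<open>d_d1_attained\<close>).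

  For the upper bound, at least \<open>m\<close> of the \<open>l i\<close> are nonzero for each \<open>v \<noteq> 0\<close>, so the \<open>m\<close>-th elementary
  symmetric polynomial of their squares is positive; it depends continuously on \<open>(v, P)\<close>, and the pairs
  with \<open>norm v = 1\<close> form a compact set.  Homogeneity turns the resulting positive minimum into
  \<open>(\<Prod>i\<in>UNIV. 1 + 4 * (l i)\<^sup>2) \<ge> c * (1 + (norm v)\<^sup>2) ^ m\<close>, which is the decay in \<open>v\<close>.  Since the
  eigenvalues are \<open>O(norm v)\<close>, the exponential factor is at most \<open>exp (- y)\<close> with
  \<open>y = (norm u)\<^sup>2 / (L * (1 + (norm v)\<^sup>2))\<close>, and trading it for \<open>(1 + y) ^ (- m)\<close> supplies the decay in
  \<open>u\<close>.  For optimality, the integral is evaluated along the ray \<open>(0, t *\<^sub>R v)\<close> with \<open>A\<^sub>v\<close> of rank \<open>m\<close>,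
  where only \<open>m\<close> factors decay.
\<close>

section \<open>Gaussian oscillatory integrals\<close>

lemma integrable_gaussian:
  fixes c :: real assumes "c > 0"
  shows "integrable lborel (\<lambda>t. exp (- (c * t\<^sup>2)))"
proof -
  define s where "s = sqrt (1 / (2 * c))"
  have s: "s > 0" "s\<^sup>2 = 1 / (2 * c)" using assms by (auto simp: s_def)
  have "integrable lborel (\<lambda>t. sqrt (2 * pi * s\<^sup>2) * normal_density 0 s t)"
    using s by (intro integrable_mult_right integrable_normal_density) auto
  moreover have "sqrt (2 * pi * s\<^sup>2) * normal_density 0 s t = exp (- (c * t\<^sup>2))" for t
    using s assms by (simp add: normal_density_def)
  ultimately show ?thesis by simp
qed

text \<open>
  The substitution \<open>s = sqrt (2 * c)\<close> reduces this to the characteristic function of the standard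
  normal distribution.
\<close>

lemma fourier_gaussian:
  fixes b c :: real assumes "c > 0"
  shows "(LINT t|lborel. cis (b * t) * of_real (exp (- (c * t\<^sup>2)))) = of_real (sqrt (pi / c) * exp (- (b\<^sup>2 / (4 * c))))"
proof -
  define s where "s = sqrt (2 * c)"
  have s: "s > 0" "s\<^sup>2 = 2 * c" using assms by (auto simp: s_def)
  have "(LINT t|lborel. cis (b * t) * of_real (exp (- (c * t\<^sup>2))))
      = (LINT t|lborel. (1 / s) *\<^sub>R (cis ((b / s) * t) * of_real (exp (- (t\<^sup>2) / 2))))"
    using s assms by (subst lborel_integral_real_affine[where c = "1 / s" and t = 0])
      (auto simp: power_divide power_mult_distrib scaleR_conv_of_real)
  also have "\<dots> = (LINT t|lborel. (sqrt (2 * pi) / s) *\<^sub>R (std_normal_density t *\<^sub>R cis ((b / s) * t)))"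
    by (intro Bochner_Integration.integral_cong) (auto simp: normal_density_def scaleR_conv_of_real field_simps)
  also have "\<dots> = (sqrt (2 * pi) / s) *\<^sub>R (LINT t|lborel. std_normal_density t *\<^sub>R cis ((b / s) * t))"
    by (rule integral_scaleR_right)
  also have "(LINT t|lborel. std_normal_density t *\<^sub>R cis ((b / s) * t)) = (LINT t|std_normal_distribution. cis ((b / s) * t))"
    by (subst integral_density) (auto simp: cis_conv_exp)
  also have "(LINT t|std_normal_distribution. cis ((b / s) * t)) = char std_normal_distribution (b / s)"
    by (simp add: char_def cis_conv_exp)
  also have "\<dots> = of_real (exp (- (b\<^sup>2 / (4 * c))))"
    using s by (simp add: char_std_normal_distribution power_divide)
  also have "sqrt (2 * pi) / s = sqrt (pi / c)"
    using assms by (simp add: s_def real_sqrt_divide[symmetric] del: real_sqrt_divide)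
  finally show ?thesis by (simp add: scaleR_conv_of_real)
qed

text \<open>
  The one-dimensional factor of the integrand: frequency \<open>a\<close>, chirp rate \<open>l\<close>, Gaussian envelope.
\<close>

definition chirp :: "real \<Rightarrow> real \<Rightarrow> real \<Rightarrow> complex" where
  "chirp a l t = cis (a * t + l * t\<^sup>2) * of_real (exp (- (t\<^sup>2 / 2)))"

lemma norm_chirp: "norm (chirp a l t) = exp (- ((1 / 2) * t\<^sup>2))"
  by (simp add: chirp_def norm_mult)

lemma measurable_chirp [measurable]: "chirp a l \<in> borel_measurable borel"
  unfolding chirp_def[abs_def] cis_conv_exp by measurable

lemma integrable_chirp: "integrable lborel (chirp a l)"
proof (rule Bochner_Integration.integrable_bound)
  show "integrable lborel (\<lambda>t::real. exp (- ((1 / 2) * t\<^sup>2)))" by (rule integrable_gaussian) simp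
qed (auto simp: norm_chirp)

text \<open>
  The phases at \<open>t + p / 2\<close> and \<open>t - p / 2\<close> differ by a function that is linear in \<open>t\<close>, so integrating
  in \<open>t\<close> and then in \<open>p\<close> only ever meets Fourier transforms of real Gaussians.
\<close>

lemma chirp_correlation:
  "chirp a l (t + p / 2) * cnj (chirp a l (t - p / 2)) =
    (cis (a * p) * of_real (exp (- ((1 / 4) * p\<^sup>2)))) * (cis ((2 * l * p) * t) * of_real (exp (- (1 * t\<^sup>2))))"
proof -
  have A: "cis x * of_real u * (cis y * of_real v) = cis (x + y) * complex_of_real (u * v)" for x y u v
    by (simp add: cis_mult[symmetric])
  have "a * (t + p/2) + l * (t + p/2)\<^sup>2 + - (a * (t - p/2) + l * (t - p/2)\<^sup>2) = a * p + (2 * l * p) * t"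
    by (simp add: power2_eq_square algebra_simps)
  moreover have "exp (- ((t + p/2)\<^sup>2 / 2)) * exp (- ((t - p/2)\<^sup>2 / 2)) = exp (- ((1 / 4) * p\<^sup>2)) * exp (- (1 * t\<^sup>2))"
    by (simp add: exp_add[symmetric] power2_eq_square field_simps)
  ultimately show ?thesis
    by (simp only: chirp_def complex_cnj_mult cis_cnj complex_cnj_complex_of_real A)
qed

text \<open>
  The integral itself involves a complex square root, but the square of its modulus does not.  It is the
  double integral of \<open>chirp a l t * cnj (chirp a l s)\<close>; in the coordinates \<open>p = t - s\<close> and
  \<open>t - p / 2\<close> both integrations are instances of \<open>fourier_gaussian\<close>.
\<close>

lemma norm_integral_chirp:
  "(norm (LINT t|lborel. chirp a l t))\<^sup>2 = 2 * pi / sqrt (1 + 4 * l\<^sup>2) * exp (- (a\<^sup>2 / (1 + 4 * l\<^sup>2)))"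
proof -
  let ?g = "chirp a l"
  have int_shift: "integrable lborel (\<lambda>p. ?g (t - p))" for t
    using lborel_integrable_real_affine[OF integrable_chirp, where c = "-1" and t = t] by simp
  have fub: "integrable (lborel \<Otimes>\<^sub>M lborel) (\<lambda>(t, p). ?g t * cnj (?g (t - p)))"
  proof (rule lborel_pair.Fubini_integrable)
    show "(\<lambda>(t, p). ?g t * cnj (?g (t - p))) \<in> borel_measurable (lborel \<Otimes>\<^sub>M lborel)"
    proof -
      have [measurable]: "cnj \<in> borel_measurable borel"
        by (intro borel_measurable_continuous_onI continuous_intros)
      show ?thesis by measurable
    qed
    have "(LINT p|lborel. norm (?g t * cnj (?g (t - p)))) = norm (?g t) * (LINT p|lborel. norm (?g p))" for t
      using lborel_integral_real_affine[where c = "-1" and t = t and f = "\<lambda>p. norm (?g p)"]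
      by (simp add: norm_mult)
    then show "integrable lborel (\<lambda>t. LINT p|lborel. norm (case (t, p) of (t, p) \<Rightarrow> ?g t * cnj (?g (t - p))))"
      using integrable_chirp by simp
    show "AE t in lborel. integrable lborel (\<lambda>p. case (t, p) of (t, p) \<Rightarrow> ?g t * cnj (?g (t - p)))"
      using int_shift by simp
  qed
  have "of_real ((norm (LINT t|lborel. ?g t))\<^sup>2) = (LINT t|lborel. ?g t) * cnj (LINT t|lborel. ?g t)"
    by (rule complex_norm_square)
  also have "\<dots> = (LINT t|lborel. ?g t * cnj (LINT s|lborel. ?g s))"
    by simp
  also have "\<dots> = (LINT t|lborel. LINT p|lborel. ?g t * cnj (?g (t - p)))"
  proof (intro Bochner_Integration.integral_cong refl)
    fix t :: real
    have "(LINT s|lborel. ?g s) = (LINT p|lborel. ?g (t - p))"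
      using lborel_integral_real_affine[where c = "-1" and t = t and f = ?g] by simp
    then show "?g t * cnj (LINT s|lborel. ?g s) = (LINT p|lborel. ?g t * cnj (?g (t - p)))"
      by simp
  qed
  also have "\<dots> = (LINT p|lborel. LINT t|lborel. ?g t * cnj (?g (t - p)))"
    using lborel_pair.Fubini_integral[OF fub] by simp
  also have "\<dots> = (LINT p|lborel. of_real (sqrt pi) * (cis (a * p) * of_real (exp (- ((1 / 4 + l\<^sup>2) * p\<^sup>2)))))"
  proof (intro Bochner_Integration.integral_cong refl)
    fix p :: real
    \<comment> \<open>Recentring at the midpoint of \<open>t\<close> and \<open>t - p\<close> removes the quadratic part of the phase.\<close>
    have "(LINT t|lborel. ?g t * cnj (?g (t - p))) = (LINT t|lborel. ?g (t + p/2) * cnj (?g (t - p/2)))"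
      using lborel_integral_real_affine[where c = 1 and t = "p / 2" and f = "\<lambda>t. ?g t * cnj (?g (t - p))"]
      by (simp add: algebra_simps)
    also have "\<dots> = (cis (a * p) * of_real (exp (- ((1 / 4) * p\<^sup>2)))) * of_real (sqrt (pi / 1) * exp (- ((2 * l * p)\<^sup>2 / (4 * 1))))"
      unfolding chirp_correlation by (subst integral_mult_right_zero) (subst fourier_gaussian, auto)
    also have "\<dots> = of_real (sqrt pi) * (cis (a * p) * of_real (exp (- ((1 / 4) * p\<^sup>2)) * exp (- ((2 * l * p)\<^sup>2 / (4 * 1)))))"
      by simp
    also have "exp (- ((1 / 4) * p\<^sup>2)) * exp (- ((2 * l * p)\<^sup>2 / (4 * 1))) = exp (- ((1 / 4 + l\<^sup>2) * p\<^sup>2))"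
      by (simp add: exp_add[symmetric] power2_eq_square field_simps)
    finally show "(LINT t|lborel. ?g t * cnj (?g (t - p))) = of_real (sqrt pi) * (cis (a * p) * of_real (exp (- ((1 / 4 + l\<^sup>2) * p\<^sup>2))))" .
  qed
  also have "\<dots> = of_real (sqrt pi) * of_real (sqrt (pi / (1 / 4 + l\<^sup>2)) * exp (- (a\<^sup>2 / (4 * (1 / 4 + l\<^sup>2)))))"
    by (subst integral_mult_right_zero, subst fourier_gaussian) (auto intro: add_pos_nonneg)
  also have "\<dots> = of_real (sqrt pi * (sqrt (pi / (1 / 4 + l\<^sup>2)) * exp (- (a\<^sup>2 / (4 * (1 / 4 + l\<^sup>2))))))"
    by simp
  finally have E: "(norm (LINT t|lborel. ?g t))\<^sup>2 = sqrt pi * (sqrt (pi / (1 / 4 + l\<^sup>2)) * exp (- (a\<^sup>2 / (4 * (1 / 4 + l\<^sup>2)))))"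
    by (simp only: of_real_eq_iff)
  have "4 * (1 / 4 + l\<^sup>2) = 1 + 4 * l\<^sup>2" by simp
  moreover have "sqrt pi * sqrt (pi / (1 / 4 + l\<^sup>2)) = 2 * pi / sqrt (1 + 4 * l\<^sup>2)"
  proof -
    have "pi / (1 / 4 + l\<^sup>2) = 4 * pi / (1 + 4 * l\<^sup>2)"
      by (simp add: field_simps add_pos_nonneg)
    then show ?thesis by (simp add: real_sqrt_divide real_sqrt_mult)
  qed
  ultimately show ?thesis unfolding E by (simp add: mult.assoc[symmetric])
qed

lemma integral_lborel_vec_prod:
  fixes f :: "'d::finite \<Rightarrow> real \<Rightarrow> complex"
  assumes "\<And>i. integrable lborel (f i)"
  shows "(LINT x|(lborel :: (real ^ 'd) measure). (\<Prod>i\<in>UNIV. f i (x $ i))) = (\<Prod>i\<in>UNIV. (LINT t|lborel. f i t))"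
proof -
  interpret product_sigma_finite "\<lambda>b :: real ^ 'd. lborel :: real measure" ..
  have [measurable]: "f i \<in> borel_measurable borel" for i
    using borel_measurable_integrable[OF assms[of i]] by simp
  have bij: "bij_betw (\<lambda>i::'d. axis i (1::real)) UNIV Basis"
    by (auto simp: bij_betw_def inj_on_def axis_eq_axis Basis_vec_def)
  define g where "g b = f (the_inv_into UNIV (\<lambda>i. axis i (1::real)) b)" for b
  have g: "g (axis i 1) = f i" for i
    unfolding g_def by (subst the_inv_into_f_f) (auto simp: inj_on_def axis_eq_axis)
  have gint: "integrable lborel (g b)" for b by (simp add: g_def assms)
  have "(LINT x|(lborel :: (real ^ 'd) measure). (\<Prod>i\<in>UNIV. f i (x $ i)))
      = (LINT y|(\<Pi>\<^sub>M b\<in>(Basis :: (real ^ 'd) set). lborel). (\<Prod>i\<in>UNIV. f i ((\<Sum>b\<in>Basis. y b *\<^sub>R b) $ i)))"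
    by (subst lborel_eq, subst integral_distr) auto
  also have "\<dots> = (LINT y|(\<Pi>\<^sub>M b\<in>(Basis :: (real ^ 'd) set). lborel). (\<Prod>b\<in>Basis. g b (y b)))"
  proof (intro Bochner_Integration.integral_cong refl)
    fix y :: "real ^ 'd \<Rightarrow> real"
    have "(\<Sum>b\<in>Basis. y b *\<^sub>R b) $ i = y (axis i 1)" for i
      using inner_sum_left_Basis[of "axis i 1" y] by (simp add: inner_axis)
    then show "(\<Prod>i\<in>UNIV. f i ((\<Sum>b\<in>Basis. y b *\<^sub>R b) $ i)) = (\<Prod>b\<in>Basis. g b (y b))"
      using prod.reindex_bij_betw[OF bij, of "\<lambda>b. g b (y b)"] by (simp add: g)
  qed
  also have "\<dots> = (\<Prod>b\<in>(Basis :: (real ^ 'd) set). (LINT t|lborel. g b t))"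
    by (rule product_integral_prod) (auto intro: gint)
  also have "\<dots> = (\<Prod>i\<in>UNIV. (LINT t|lborel. f i t))"
    using prod.reindex_bij_betw[OF bij, of "\<lambda>b. LINT t|lborel. g b t"] by (simp add: g)
  finally show ?thesis .
qed

text \<open>
  Rotation invariance follows from translation invariance and Fubini alone.  For the unit ball \<open>B\<close>, the
  product \<open>|B| * |T -` A|\<close> is a double integral; translating each variable by the image of
  the other under \<open>T\<close> or its inverse moves the factor that contains \<open>T\<close> from \<open>A\<close> to the ball, and a ball is mapped by an isometry to a
  ball of the same measure.  Dividing by \<open>|B|\<close>, which is positive and finite, gives the claim.
\<close>

lemma lborel_distr_orthogonal:
  fixes T :: "'a::euclidean_space \<Rightarrow> 'a"
  assumes T: "orthogonal_transformation T"
  shows "distr lborel borel T = lborel"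
proof (rule measure_eqI)
  have lin: "linear T" using T by (rule orthogonal_transformation_linear)
  have [measurable]: "T \<in> borel_measurable borel"
    using lin by (intro borel_measurable_continuous_onI linear_continuous_on linear_conv_bounded_linear[THEN iffD1])
  define B :: "'a set" where "B = ball 0 1"
  have [measurable]: "B \<in> sets borel" by (simp add: B_def)
  have inv: "T (inv T x) = x" for x
    by (rule surj_f_inv_f[OF orthogonal_transformation_surj[OF T]])
  fix A :: "'a set" assume "A \<in> sets (distr lborel borel T)"
  then have [measurable]: "A \<in> sets borel" by simp
  have "emeasure lborel B * emeasure (distr lborel borel T) A
      = emeasure lborel B * (\<integral>\<^sup>+y. indicator A (T y) \<partial>lborel)"
    by (subst nn_integral_indicator[symmetric], simp, subst nn_integral_distr) auto
  also have "\<dots> = (\<integral>\<^sup>+x. indicator B x * (\<integral>\<^sup>+y. indicator A (T y) \<partial>lborel) \<partial>lborel)"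
    by (simp add: nn_integral_multc)
  \<comment> \<open>Translate \<open>y\<close> by \<open>inv T x\<close>.\<close>
  also have "\<dots> = (\<integral>\<^sup>+x. (\<integral>\<^sup>+y. indicator B x * indicator A (T y + x) \<partial>lborel) \<partial>lborel)"
  proof (rule nn_integral_cong)
    fix x :: 'a
    have "(\<integral>\<^sup>+y. indicator A (T y) \<partial>lborel) = (\<integral>\<^sup>+y. indicator A (T y) \<partial>distr lborel borel ((+) (inv T x)))"
      by (simp add: lborel_distr_plus)
    also have "\<dots> = (\<integral>\<^sup>+y. indicator A (T y + x) \<partial>lborel)"
      by (subst nn_integral_distr) (auto simp: linear_add[OF lin] inv add.commute)
    finally show "indicator B x * (\<integral>\<^sup>+y. indicator A (T y) \<partial>lborel)
        = (\<integral>\<^sup>+y. indicator B x * indicator A (T y + x) \<partial>lborel)"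
      by (simp add: nn_integral_cmult)
  qed
  also have "\<dots> = (\<integral>\<^sup>+y. (\<integral>\<^sup>+x. indicator B x * indicator A (T y + x) \<partial>lborel) \<partial>lborel)"
    by (rule lborel_pair.Fubini'[symmetric]) measurable
  \<comment> \<open>Translate \<open>x\<close> by \<open>- T y\<close>.\<close>
  also have "\<dots> = (\<integral>\<^sup>+y. (\<integral>\<^sup>+x. indicator B (x - T y) * indicator A x \<partial>lborel) \<partial>lborel)"
  proof (rule nn_integral_cong)
    fix y :: 'a
    have "(\<integral>\<^sup>+x. indicator B (x - T y) * indicator A x \<partial>lborel)
        = (\<integral>\<^sup>+x. indicator B (x - T y) * indicator A x \<partial>distr lborel borel ((+) (T y)))"
      by (simp add: lborel_distr_plus)
    also have "\<dots> = (\<integral>\<^sup>+x. indicator B x * indicator A (T y + x) \<partial>lborel)"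
      by (subst nn_integral_distr) auto
    finally show "(\<integral>\<^sup>+x. indicator B x * indicator A (T y + x) \<partial>lborel)
        = (\<integral>\<^sup>+x. indicator B (x - T y) * indicator A x \<partial>lborel)" by simp
  qed
  also have "\<dots> = (\<integral>\<^sup>+x. (\<integral>\<^sup>+y. indicator B (x - T y) * indicator A x \<partial>lborel) \<partial>lborel)"
    by (rule lborel_pair.Fubini') measurable
  also have "\<dots> = (\<integral>\<^sup>+x. emeasure lborel B * indicator A x \<partial>lborel)"
  proof (rule nn_integral_cong)
    fix x :: 'a
    have "indicator B (x - T y) = (indicator (ball (inv T x) 1) y :: ennreal)" for y
    proof -
      have "norm (x - T y) = norm (T (inv T x - y))" by (simp add: linear_diff[OF lin] inv)
      also have "\<dots> = dist (inv T x) y" by (simp add: orthogonal_transformation_norm[OF T] dist_norm)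
      finally show ?thesis by (simp add: B_def indicator_def)
    qed
    then have "(\<integral>\<^sup>+y. indicator B (x - T y) \<partial>lborel) = emeasure lborel (ball (inv T x) 1)" by simp
    also have "\<dots> = emeasure lborel B" by (simp add: B_def emeasure_ball)
    finally show "(\<integral>\<^sup>+y. indicator B (x - T y) * indicator A x \<partial>lborel) = emeasure lborel B * indicator A x"
      by (simp add: nn_integral_multc)
  qed
  also have "\<dots> = emeasure lborel B * emeasure lborel A" by (simp add: nn_integral_cmult)
  finally show "emeasure (distr lborel borel T) A = emeasure lborel A"
    using unit_ball_vol_pos[of "real DIM('a)"]
    by (subst (asm) ennreal_mult_cancel_left) (auto simp: B_def emeasure_ball simp del: unit_ball_vol_pos)
qed simp

text \<open>
  In the coordinates given by \<open>P\<close> the quadratic phase separates, while the linear phase \<open>u\<close> becomes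
  \<open>transpose P *v u\<close> and the Gaussian weight keeps its form because \<open>P\<close> is an isometry.
\<close>

lemma norm_gaussian_oscillatory_integral:
  fixes P :: "real ^ 'd ^ 'd"
  assumes P: "orthogonal_matrix P" and q: "\<And>\<xi>. q (P *v \<xi>) = (\<Sum>i\<in>UNIV. l i * (\<xi> $ i)\<^sup>2)"
    and [measurable]: "q \<in> borel_measurable borel"
  shows "(norm (LINT \<xi>|lborel. exp (\<i> * of_real (u \<bullet> \<xi> + q \<xi>)) * of_real (exp (- (norm \<xi>)\<^sup>2 / 2))))\<^sup>2
     = (\<Prod>i\<in>UNIV. 2 * pi / sqrt (1 + 4 * (l i)\<^sup>2) * exp (- (((transpose P *v u) $ i)\<^sup>2 / (1 + 4 * (l i)\<^sup>2))))"
proof -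
  let ?T = "\<lambda>\<xi>. P *v \<xi>"
  have T: "orthogonal_transformation ?T"
    using P by (simp add: orthogonal_transformation_matrix)
  have [measurable]: "?T \<in> borel_measurable borel"
    by (intro borel_measurable_continuous_onI linear_continuous_on linear_conv_bounded_linear[THEN iffD1] matrix_vector_mul_linear)
  define F where "F \<xi> = exp (\<i> * of_real (u \<bullet> \<xi> + q \<xi>)) * complex_of_real (exp (- (norm \<xi>)\<^sup>2 / 2))" for \<xi>
  have [measurable]: "F \<in> borel_measurable borel" unfolding F_def by measurable
  define a where "a = transpose P *v u"
  have "(LINT \<xi>|lborel. F \<xi>) = (LINT \<xi>|distr lborel borel ?T. F \<xi>)"
    by (simp add: lborel_distr_orthogonal[OF T])
  also have "\<dots> = (LINT \<xi>|lborel. F (P *v \<xi>))" by (subst integral_distr) auto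
  also have "\<dots> = (LINT \<xi>|lborel. (\<Prod>i\<in>UNIV. chirp (a $ i) (l i) (\<xi> $ i)))"
  proof (intro Bochner_Integration.integral_cong refl)
    fix \<xi> :: "real ^ 'd"
    have "u \<bullet> (P *v \<xi>) = a \<bullet> \<xi>" by (simp add: a_def dot_lmul_matrix[symmetric])
    then have "u \<bullet> (P *v \<xi>) + q (P *v \<xi>) = (\<Sum>i\<in>UNIV. a $ i * \<xi> $ i + l i * (\<xi> $ i)\<^sup>2)"
      by (simp add: q inner_vec_def sum.distrib)
    moreover have "- (norm (P *v \<xi>))\<^sup>2 / 2 = (\<Sum>i\<in>UNIV. - ((\<xi> $ i)\<^sup>2 / 2))"
    proof -
      have "(norm (P *v \<xi>))\<^sup>2 = (norm \<xi>)\<^sup>2" using orthogonal_transformation_norm[OF T] by simp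
      also have "\<dots> = (\<Sum>i\<in>UNIV. (\<xi> $ i)\<^sup>2)"
        unfolding power2_norm_eq_inner inner_vec_def by (simp add: power2_eq_square)
      finally show ?thesis by (simp add: sum_negf sum_divide_distrib)
    qed
    ultimately show "F (P *v \<xi>) = (\<Prod>i\<in>UNIV. chirp (a $ i) (l i) (\<xi> $ i))"
      by (simp add: F_def chirp_def cis_conv_exp prod.distrib exp_sum sum_distrib_left)
  qed
  also have "\<dots> = (\<Prod>i\<in>UNIV. (LINT t|lborel. chirp (a $ i) (l i) t))"
    by (rule integral_lborel_vec_prod) (rule integrable_chirp)
  finally show ?thesis
    unfolding F_def[symmetric] a_def[symmetric]
    by (simp add: prod_norm[symmetric] prod_power_distrib norm_integral_chirp)
qed

section \<open>Diagonalization of symmetric matrices\<close>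

text \<open>
  The spectral theorem, by induction on the dimension.  A maximizer \<open>e\<close> of the quadratic form on the unit
  sphere of \<open>S\<close> is an eigenvector: at \<open>e\<close> the nonnegative form \<open>\<mu> * (y \<bullet> y) - y \<bullet> f y\<close> vanishes, so
  its first variation in the direction \<open>w = \<mu> *\<^sub>R e - f e\<close> vanishes as well, and that variation is twice
  \<open>w \<bullet> w\<close>.  The orthogonal complement of \<open>e\<close> in \<open>S\<close> is again invariant.
\<close>

lemma selfadjoint_eigenbasis_subspace:
  fixes f :: "'a::euclidean_space \<Rightarrow> 'a"
  assumes lin: "linear f" and sa: "\<And>x y. f x \<bullet> y = x \<bullet> f y"
  assumes "subspace S" and "f ` S \<subseteq> S"
  shows "\<exists>B. B \<subseteq> S \<and> span B = S \<and> pairwise orthogonal B \<and> (\<forall>b\<in>B. norm b = 1 \<and> (\<exists>c. f b = c *\<^sub>R b))"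
  using assms(3,4)
proof (induction "dim S" arbitrary: S rule: less_induct)
  case less
  note S = less.prems
  show ?case
  proof (cases "S = {0}")
    case True
    then show ?thesis by (intro exI[of _ "{}"]) auto
  next
    case False
    then obtain x where x: "x \<in> S" "x \<noteq> 0" using S(1) subspace_0 by blast
    have cf: "continuous_on A f" for A
      using lin by (simp add: linear_continuous_on linear_conv_bounded_linear)
    have "compact (S \<inter> sphere 0 1)"
      by (intro closed_Int_compact closed_subspace S) simp
    moreover have "x /\<^sub>R norm x \<in> S \<inter> sphere 0 1"
      using x S(1) by (simp add: subspace_scale)
    ultimately obtain e where e: "e \<in> S" "norm e = 1"
      and max: "\<And>y. y \<in> S \<Longrightarrow> norm y = 1 \<Longrightarrow> y \<bullet> f y \<le> e \<bullet> f e"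
      using continuous_attains_sup[of "S \<inter> sphere 0 1" "\<lambda>y. y \<bullet> f y"]
      by (force intro: continuous_on_inner continuous_on_id cf)
    define \<mu> where "\<mu> = e \<bullet> f e"
    have nonneg: "0 \<le> \<mu> * (y \<bullet> y) - y \<bullet> f y" if "y \<in> S" for y
    proof (cases "y = 0")
      case False
      have "(y /\<^sub>R norm y) \<bullet> f (y /\<^sub>R norm y) \<le> \<mu>"
        unfolding \<mu>_def using that False S(1) by (intro max) (auto simp: subspace_scale)
      then have "(y \<bullet> f y) / (norm y)\<^sup>2 \<le> \<mu>"
        by (simp add: linear_scale[OF lin] power2_eq_square field_simps)
      then show ?thesis using False by (simp add: field_simps dot_square_norm)
    qed (simp add: linear_0[OF lin])
    define w where "w = \<mu> *\<^sub>R e - f e"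
    have w: "w \<in> S" unfolding w_def using S e by (auto intro!: subspace_diff subspace_scale)
    have "w \<bullet> w = 0"
    proof (rule ccontr)
      assume nz: "w \<bullet> w \<noteq> 0"
      define g where "g = \<mu> * (w \<bullet> w) - w \<bullet> f w"
      have quad: "0 \<le> 2 * t * (w \<bullet> w) + t\<^sup>2 * g" for t
      proof -
        have "e + t *\<^sub>R w \<in> S" using S(1) e(1) w by (simp add: subspace_add subspace_scale)
        from nonneg[OF this]
        have pos: "0 \<le> (\<mu> * (e \<bullet> e) - e \<bullet> f e) + t * (2 * (\<mu> * (e \<bullet> w)) - (e \<bullet> f w + w \<bullet> f e)) + t\<^sup>2 * g"
          by (simp add: linear_add[OF lin] linear_scale[OF lin] inner_add g_def inner_commute[of w e] power2_eq_square algebra_simps)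
        moreover have "e \<bullet> f w = f e \<bullet> w" by (simp add: sa)
        moreover have "\<mu> * (e \<bullet> e) - e \<bullet> f e = 0" using e by (simp add: \<mu>_def dot_square_norm)
        moreover have "w \<bullet> w = \<mu> * (e \<bullet> w) - f e \<bullet> w" by (simp add: w_def inner_diff_left)
        ultimately have "t * (2 * (\<mu> * (e \<bullet> w)) - (e \<bullet> f w + w \<bullet> f e)) = 2 * t * (w \<bullet> w)"
            "\<mu> * (e \<bullet> e) - e \<bullet> f e = 0"
          by (simp_all only: inner_commute[of w "f e"]) (simp add: algebra_simps)
        with pos show ?thesis by simp
      qed
      have pos: "w \<bullet> w > 0" using nz by simp
      \<comment> \<open>Small enough for the linear term \<open>2 * s * (w \<bullet> w)\<close>, which is negative, to dominate \<open>s\<^sup>2 * g\<close>.\<close>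
      define s where "s = - (w \<bullet> w) / (1 + \<bar>g\<bar>)"
      have "\<bar>s * g\<bar> = (w \<bullet> w) * (\<bar>g\<bar> / (1 + \<bar>g\<bar>))" using pos by (simp add: s_def abs_mult abs_divide)
      also have "\<dots> \<le> (w \<bullet> w) * 1" using pos by (intro mult_left_mono) (auto simp: field_simps)
      finally have "2 * (w \<bullet> w) + s * g > 0" using pos by linarith
      moreover have "s < 0" using pos by (simp add: s_def field_simps add_pos_nonneg)
      ultimately have "s * (2 * (w \<bullet> w) + s * g) < 0" by (rule mult_neg_pos[rotated])
      with quad[of s] show False by (simp add: power2_eq_square algebra_simps)
    qed
    then have fe: "f e = \<mu> *\<^sub>R e" by (simp add: w_def)
    define S' where "S' = S \<inter> {y. e \<bullet> y = 0}"
    have S': "subspace S'" unfolding S'_def by (intro subspace_inter S subspace_hyperplane)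
    have "f ` S' \<subseteq> S'"
      using S(2) by (auto simp: S'_def sa[symmetric] fe)
    moreover have "dim S' < dim S"
    proof (rule dim_psubset)
      have "e \<notin> S'" using e by (auto simp: S'_def)
      moreover have "S' \<subseteq> S" by (auto simp: S'_def)
      ultimately have "S' \<subset> S" using e(1) unfolding psubset_eq by metis
      then show "span S' \<subset> span S" using S(1) S' by (simp add: span_eq_iff[THEN iffD2])
    qed
    ultimately obtain B where B: "B \<subseteq> S'" "span B = S'" "pairwise orthogonal B"
        "\<forall>b\<in>B. norm b = 1 \<and> (\<exists>c. f b = c *\<^sub>R b)"
      using less.hyps[OF _ S'] by blast
    have "S \<subseteq> span (insert e B)"
    proof
      fix y assume y: "y \<in> S"
      have "y - (e \<bullet> y) *\<^sub>R e \<in> S'"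
        using y e S(1) by (auto simp: S'_def subspace_diff subspace_scale inner_diff_right dot_square_norm)
      then show "y \<in> span (insert e B)" unfolding span_insert B(2) by blast
    qed
    moreover have "span (insert e B) \<subseteq> S"
      using B(1) e(1) S(1) by (intro span_minimal) (auto simp: S'_def)
    moreover have "pairwise orthogonal (insert e B)"
      using B(1,3) by (force simp: pairwise_insert orthogonal_def S'_def inner_commute)
    ultimately show ?thesis
      using B e fe by (intro exI[of _ "insert e B"]) (auto simp: S'_def)
  qed
qed

text \<open>
  Stated through the columns of \<open>P\<close>, which form an orthonormal basis of eigenvectors, rather than through
  a product of matrices.  The eigenvalues come in no particular order.
\<close>

definition diagonalizes :: "real ^ 'd ^ 'd \<Rightarrow> ('d \<Rightarrow> real) \<Rightarrow> real ^ 'd ^ 'd \<Rightarrow> bool" where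
  "diagonalizes P l A \<longleftrightarrow> orthogonal_matrix P \<and> (\<forall>i. A *v column i P = l i *\<^sub>R column i P)"

lemma column_eq_mult_axis: "column i (P :: real ^ 'd ^ 'd) = P *v axis i 1"
  by (simp add: matrix_vector_mult_basis)

lemma symmetric_inner_mult:
  fixes A :: "real ^ 'd ^ 'd"
  assumes "transpose A = A" shows "(A *v x) \<bullet> y = x \<bullet> (A *v y)"
  by (metis assms dot_lmul_matrix inner_commute transpose_matrix_vector)

lemma symmetric_diagonalizable:
  fixes A :: "real ^ 'd ^ 'd"
  assumes "transpose A = A"
  shows "\<exists>P l. diagonalizes P l A"
proof -
  have "\<exists>B. B \<subseteq> UNIV \<and> span B = UNIV \<and> pairwise orthogonal B \<and> (\<forall>b\<in>B. norm b = 1 \<and> (\<exists>c. A *v b = c *\<^sub>R b))"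
    by (rule selfadjoint_eigenbasis_subspace) (auto simp: matrix_vector_mul_linear symmetric_inner_mult[OF assms])
  then obtain B where B: "span B = UNIV" "pairwise orthogonal B"
      "\<And>b. b \<in> B \<Longrightarrow> norm b = 1" "\<And>b. b \<in> B \<Longrightarrow> \<exists>c. A *v b = c *\<^sub>R b" by blast
  have "independent B" using B(2,3) by (intro pairwise_orthogonal_independent) force+
  then have fin: "finite B" and card: "card B = CARD('d)"
    using B(1) dim_unique[of B UNIV "card B"] by (auto simp: independent_imp_finite)
  then obtain h where h: "bij_betw h (UNIV :: 'd set) B"
    using finite_same_card_bij[of "UNIV :: 'd set" B] by auto
  have hB: "h i \<in> B" for i using h by (auto simp: bij_betw_def)
  define P :: "real ^ 'd ^ 'd" where "P = (\<chi> j i. h i $ j)"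
  have col: "column i P = h i" for i by (simp add: column_def P_def)
  have "\<forall>i. \<exists>c. A *v h i = c *\<^sub>R h i" using B(4)[OF hB] by blast
  then obtain l where "\<And>i. A *v h i = l i *\<^sub>R h i" by metis
  moreover have "orthogonal_matrix P"
  proof -
    have "h i \<noteq> h j" if "i \<noteq> j" for i j
      using h that by (auto simp: bij_betw_def inj_on_def)
    then show ?thesis
      unfolding orthogonal_matrix_orthonormal_columns col
      by (intro conjI allI impI B(3)[OF hB] pairwiseD[OF B(2) hB hB])
  qed
  ultimately show ?thesis
    unfolding diagonalizes_def by (intro exI[of _ P] exI[of _ l]) (simp add: col)
qed

lemma diagonalizes_mult:
  assumes "diagonalizes P l A"
  shows "A *v (P *v \<xi>) = P *v (\<chi> i. l i * \<xi> $ i)"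
proof -
  have "A *v (P *v \<xi>) = (\<Sum>i\<in>UNIV. \<xi> $ i *\<^sub>R (A *v column i P))"
    by (simp add: matrix_mult_sum[of P] matrix_vector_mult_scaleR linear_sum[OF matrix_vector_mul_linear] scalar_mult_eq_scaleR)
  also have "\<dots> = P *v (\<chi> i. l i * \<xi> $ i)"
    using assms by (simp add: diagonalizes_def matrix_mult_sum[of P] scalar_mult_eq_scaleR mult.commute)
  finally show ?thesis .
qed

lemma orthogonal_matrix_inner:
  fixes P :: "real ^ 'd ^ 'd"
  assumes "orthogonal_matrix P"
  shows "(P *v x) \<bullet> (P *v y) = x \<bullet> y"
  using assms orthogonal_transformation_matrix[of "(*v) P"]
  by (simp add: orthogonal_transformation_def)

lemma diagonalizes_form:
  assumes "diagonalizes P l A"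
  shows "(P *v \<xi>) \<bullet> (A *v (P *v \<xi>)) = (\<Sum>i\<in>UNIV. l i * (\<xi> $ i)\<^sup>2)"
proof -
  have "orthogonal_matrix P" using assms by (simp add: diagonalizes_def)
  then have "(P *v \<xi>) \<bullet> (A *v (P *v \<xi>)) = \<xi> \<bullet> (\<chi> i. l i * \<xi> $ i)"
    by (simp only: diagonalizes_mult[OF assms] orthogonal_matrix_inner)
  then show ?thesis by (simp add: inner_vec_def power2_eq_square algebra_simps)
qed

section \<open>Essential variables and rank\<close>

text \<open>
  The gradient of the form at \<open>\<xi>\<close> is \<open>2 *\<^sub>R (B *v \<xi>)\<close>, whose \<open>i\<close>-th component is twice the inner product
  of \<open>\<xi>\<close> with the \<open>i\<close>-th column of \<open>B\<close>.
\<close>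

lemma NV_symmetric_form:
  fixes B :: "real ^ 'd ^ 'd"
  assumes B: "transpose B = B"
  shows "NV (\<lambda>\<xi>. \<xi> \<bullet> (B *v \<xi>)) = card {i. B *v axis i 1 \<noteq> 0}"
proof -
  have pd: "partial_deriv i (\<lambda>\<xi>. \<xi> \<bullet> (B *v \<xi>)) \<xi> = 2 * (\<xi> \<bullet> (B *v axis i 1))" for i \<xi>
  proof -
    let ?e = "axis i 1 :: real ^ 'd"
    have "(\<xi> + t *\<^sub>R ?e) \<bullet> (B *v (\<xi> + t *\<^sub>R ?e))
        = \<xi> \<bullet> (B *v \<xi>) + 2 * t * (\<xi> \<bullet> (B *v ?e)) + t * t * (?e \<bullet> (B *v ?e))" for t
      using symmetric_inner_mult[OF B, of \<xi> ?e]
      by (simp add: matrix_vector_right_distrib matrix_vector_mult_scaleR inner_add inner_commute[of ?e "B *v \<xi>"] algebra_simps)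
    then show ?thesis unfolding partial_deriv_def
      by (intro DERIV_imp_deriv) (auto intro!: derivative_eq_intros)
  qed
  have "(\<exists>\<xi>. partial_deriv i (\<lambda>\<xi>. \<xi> \<bullet> (B *v \<xi>)) \<xi> \<noteq> 0) \<longleftrightarrow> B *v axis i 1 \<noteq> 0" for i
    unfolding pd by (metis inner_eq_zero_iff inner_zero_right mult_eq_0_iff zero_neq_numeral)
  then show ?thesis by (simp add: NV_def)
qed

text \<open>
  The substituted form has matrix \<open>transpose M ** A ** M\<close>, and the invertible left factor does not affect
  which columns vanish.
\<close>

lemma NV_substituted_form:
  fixes A M :: "real ^ 'd ^ 'd"
  assumes A: "transpose A = A" and M: "invertible M"
  shows "NV (\<lambda>\<xi>. (M *v \<xi>) \<bullet> (A *v (M *v \<xi>))) = card {i. A *v (M *v axis i 1) \<noteq> 0}"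
proof -
  let ?B = "transpose M ** A ** M"
  have "transpose ?B = ?B" by (simp add: matrix_transpose_mul A matrix_mul_assoc)
  moreover have "(M *v \<xi>) \<bullet> (A *v (M *v \<xi>)) = \<xi> \<bullet> (?B *v \<xi>)" for \<xi>
    by (metis dot_lmul_matrix matrix_vector_mul_assoc transpose_matrix_vector transpose_transpose)
  moreover have "?B *v x = 0 \<longleftrightarrow> A *v (M *v x) = 0" for x
  proof -
    have "invertible (transpose M)" using M by (simp add: transpose_invertible)
    then have "inj ((*v) (transpose M))" by (rule inj_matrix_vector_mult)
    then have "transpose M *v y = 0 \<longleftrightarrow> y = 0" for y
      by (metis injD matrix_vector_mult_0_right)
    then show ?thesis by (simp add: matrix_vector_mul_assoc[symmetric])
  qed
  ultimately show ?thesis by (simp add: NV_symmetric_form)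
qed

lemma orthogonal_matrix_invertible: "orthogonal_matrix P \<Longrightarrow> invertible (P :: real ^ 'd ^ 'd)"
  unfolding orthogonal_matrix_def invertible_def by blast

lemma NV_diagonalized:
  assumes A: "transpose A = A" and D: "diagonalizes P l A"
  shows "NV (\<lambda>\<xi>. (P *v \<xi>) \<bullet> (A *v (P *v \<xi>))) = card {i. l i \<noteq> 0}"
proof -
  have P: "orthogonal_matrix P" using D by (simp add: diagonalizes_def)
  have "norm (column i P) = 1" for i using P by (simp add: orthogonal_matrix_orthonormal_columns)
  then have "column i P \<noteq> 0" for i by (metis norm_zero zero_neq_one)
  then have "A *v (P *v axis i 1) \<noteq> 0 \<longleftrightarrow> l i \<noteq> 0" for i
    using D by (simp add: diagonalizes_def column_eq_mult_axis)
  then show ?thesis by (simp add: NV_substituted_form[OF A orthogonal_matrix_invertible[OF P]])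
qed

text \<open>
  A comparison of nullities.  A variable \<open>i\<close> that does not occur in the substituted form gives a vector
  \<open>M *v axis i 1\<close> in the kernel of \<open>A\<close>; these vectors are independent, and the kernel is spanned by the
  eigenvectors with eigenvalue \<open>0\<close>.  The count is made in the eigenbasis, that is after applying
  \<open>transpose P\<close>.
\<close>

lemma card_nonzero_eigenvalues_le_NV:
  fixes A M P :: "real ^ 'd ^ 'd"
  assumes A: "transpose A = A" and D: "diagonalizes P l A" and M: "invertible M"
  shows "card {i. l i \<noteq> 0} \<le> NV (\<lambda>\<xi>. (M *v \<xi>) \<bullet> (A *v (M *v \<xi>)))"
proof -
  have P: "orthogonal_matrix P" using D by (simp add: diagonalizes_def)
  define I where "I = {i. A *v (M *v axis i 1) = 0}"
  define J where "J = {j. l j = 0}"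
  define f where "f x = transpose P *v (M *v x)" for x
  have PP: "P *v (transpose P *v x) = x" "transpose P *v (P *v x) = x" for x
    using P by (simp_all add: matrix_vector_mul_assoc orthogonal_matrix_def del: transpose_matrix_vector)
  have linf: "linear f" unfolding f_def
    using linear_compose[OF matrix_vector_mul_linear[of M] matrix_vector_mul_linear[of "transpose P"]] by (simp add: o_def)
  have injf: "inj f"
  proof (rule injI)
    fix x y assume "f x = f y"
    then have "P *v f x = P *v f y" by simp
    then have "M *v x = M *v y" by (simp only: f_def PP)
    then show "x = y" using inj_matrix_vector_mult[OF M] by (simp add: inj_def)
  qed
  let ?e = "\<lambda>i::'d. axis i (1::real)"
  have "independent (?e ` I)"
    by (rule independent_mono[OF independent_Basis]) (auto simp: Basis_vec_def)
  then have ind: "independent (f ` ?e ` I)"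
    using linf injf by (intro linear_independent_injective_image) (auto intro: inj_on_subset)
  have "f ` ?e ` I \<subseteq> span (?e ` J)"
  proof clarify
    fix i assume "i \<in> I"
    define x where "x = f (?e i)"
    have "A *v (P *v x) = 0" using \<open>i \<in> I\<close> by (simp only: x_def f_def PP I_def mem_Collect_eq)
    then have "P *v (\<chi> i. l i * x $ i) = 0" by (simp add: diagonalizes_mult[OF D])
    then have "transpose P *v (P *v (\<chi> i. l i * x $ i)) = transpose P *v 0" by (simp only:)
    then have "(\<chi> i. l i * x $ i) = 0" by (simp only: PP matrix_vector_mult_0_right)
    then have z: "l j * x $ j = 0" for j by (simp add: vec_eq_iff)
    have "x = (\<Sum>j\<in>UNIV. x $ j *\<^sub>R ?e j)" using basis_expansion[of x] by (simp add: scalar_mult_eq_scaleR)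
    also have "\<dots> = (\<Sum>j\<in>J. x $ j *\<^sub>R ?e j)"
      using z by (intro sum.mono_neutral_right) (auto simp: J_def)
    also have "\<dots> \<in> span (?e ` J)" by (intro span_sum span_scale span_base) auto
    finally show "f (?e i) \<in> span (?e ` J)" by (simp add: x_def)
  qed
  then have "card (f ` ?e ` I) \<le> card (?e ` J)"
    using independent_span_bound[OF _ ind, of "?e ` J"] by simp
  moreover have "inj ?e" by (auto simp: inj_def axis_eq_axis)
  then have "card (?e ` X) = card X" for X
    by (intro card_image) (rule inj_on_subset, auto)
  moreover have "card (f ` X) = card X" for X
    using injf by (intro card_image) (rule inj_on_subset, auto)
  ultimately have "card I \<le> card J" by simp
  moreover have "{i. l i \<noteq> 0} = UNIV - J" "{i. A *v (M *v axis i 1) \<noteq> 0} = UNIV - I"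
    by (auto simp: I_def J_def)
  ultimately show ?thesis by (simp add: NV_substituted_form[OF A M] card_Diff_subset diff_le_mono2)
qed

lemma quadratic_form_symmetric:
  fixes q :: "real ^ 'd \<Rightarrow> real"
  assumes "quadratic_form q"
  shows "\<exists>A. transpose A = A \<and> (\<forall>\<xi>. q \<xi> = \<xi> \<bullet> (A *v \<xi>))"
proof -
  obtain A :: "real ^ 'd ^ 'd" where A: "\<And>\<xi>. q \<xi> = (\<Sum>i\<in>UNIV. \<Sum>j\<in>UNIV. A $ i $ j * \<xi> $ i * \<xi> $ j)"
    using assms by (auto simp: quadratic_form_def)
  have qA: "q \<xi> = \<xi> \<bullet> (A *v \<xi>)" for \<xi>
    by (simp add: A inner_vec_def matrix_vector_mult_def sum_distrib_left mult_ac)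
  have "\<xi> \<bullet> (transpose A *v \<xi>) = \<xi> \<bullet> (A *v \<xi>)" for \<xi>
    by (metis dot_lmul_matrix inner_commute transpose_matrix_vector)
  then have "q \<xi> = \<xi> \<bullet> (((1 / 2) *\<^sub>R (A + transpose A)) *v \<xi>)" for \<xi>
    by (simp add: qA scaleR_matrix_vector_assoc[symmetric] matrix_vector_mult_add_rdistrib inner_add_right
          del: transpose_matrix_vector)
  moreover have "transpose ((1 / 2) *\<^sub>R (A + transpose A)) = (1 / 2) *\<^sub>R (A + transpose A)"
    by (simp add: transpose_def vec_eq_iff add.commute)
  ultimately show ?thesis by blast
qed

text \<open>
  The matrix of \<open>\<xi> \<mapsto> Q \<xi> \<bullet> v\<close>, when \<open>A k\<close> is the matrix of the \<open>k\<close>-th component of \<open>Q\<close>.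
\<close>

definition pencil :: "('n::finite \<Rightarrow> real ^ 'd ^ 'd) \<Rightarrow> real ^ 'n \<Rightarrow> real ^ 'd ^ 'd" where
  "pencil A v = (\<Sum>k\<in>UNIV. v $ k *\<^sub>R A k)"

lemma pencil_mult: "pencil A v *v x = (\<Sum>k\<in>UNIV. v $ k *\<^sub>R (A k *v x))"
proof -
  have "linear (\<lambda>B. B *v x)" for x :: "real ^ 'd"
    by (rule linearI) (simp_all add: matrix_vector_mult_add_rdistrib scaleR_matrix_vector_assoc)
  from linear_sum[OF this] show ?thesis
    unfolding pencil_def by (simp add: scaleR_matrix_vector_assoc)
qed

lemma transpose_pencil:
  assumes "\<And>k. transpose (A k) = A k"
  shows "transpose (pencil A v) = pencil A v"
  using assms by (simp add: pencil_def transpose_def vec_eq_iff)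

lemma pencil_scaleR: "pencil A (t *\<^sub>R v) = t *\<^sub>R pencil A v"
  by (simp add: pencil_def scaleR_sum_right)

lemma pencil_form:
  assumes "\<And>k \<xi>. Q \<xi> $ k = \<xi> \<bullet> (A k *v \<xi>)"
  shows "Q \<xi> \<bullet> v = \<xi> \<bullet> (pencil A v *v \<xi>)"
  by (simp add: pencil_mult inner_sum_right inner_vec_def[of "Q \<xi>"] assms mult.commute)

lemma diagonalizes_scaleR:
  assumes "diagonalizes P l A" shows "diagonalizes P (\<lambda>i. t * l i) (t *\<^sub>R A)"
  using assms by (simp add: diagonalizes_def scaleR_matrix_vector_assoc[symmetric])

lemma diagonalizes_eigenvalue:
  assumes "diagonalizes P l A" shows "l i = column i P \<bullet> (A *v column i P)"
proof -
  have "column i P \<bullet> column i P = 1"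
    using assms by (simp add: diagonalizes_def orthogonal_matrix_orthonormal_columns dot_square_norm)
  then show ?thesis using assms by (simp add: diagonalizes_def)
qed

text \<open>
  Together these identify \<open>d_d1 Q\<close> with the least rank in the pencil.  The change of variables \<open>P\<close> shows
  that the infimum is at most the rank of every \<open>pencil A v\<close> with \<open>v \<noteq> 0\<close>.  Conversely, an infimum of
  natural numbers is attained, and by \<open>card_nonzero_eigenvalues_le_NV\<close> the number of variables at a
  minimizing pair bounds the rank from above.
\<close>

lemma
  fixes Q :: "real ^ 'd \<Rightarrow> real ^ 'n" and A :: "'n \<Rightarrow> real ^ 'd ^ 'd"
  assumes sym: "\<And>k. transpose (A k) = A k" and Q: "\<And>k \<xi>. Q \<xi> $ k = \<xi> \<bullet> (A k *v \<xi>)"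
  shows d_d1_le_rank: "v \<noteq> 0 \<Longrightarrow> diagonalizes P l (pencil A v) \<Longrightarrow> d_d1 Q \<le> card {i. l i \<noteq> 0}"
    and d_d1_attained: "\<exists>v. v \<noteq> 0 \<and> (\<forall>P l. diagonalizes P l (pencil A v) \<longrightarrow> card {i. l i \<noteq> 0} \<le> d_d1 Q)"
proof -
  note symp = transpose_pencil[of A, OF sym]
  note form = pencil_form[of Q A, OF Q]
  let ?F = "\<lambda>(M :: real ^ 'd ^ 'd) N. NV (\<lambda>\<xi>. Q (M *v \<xi>) \<bullet> N)"
  let ?G = "\<lambda>M :: real ^ 'd ^ 'd. INF N\<in>{N. N \<noteq> 0}. ?F M N"
  {
    assume v: "v \<noteq> 0" and D: "diagonalizes P l (pencil A v)"
    have "invertible P" using D by (simp add: diagonalizes_def orthogonal_matrix_invertible)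
    then have "d_d1 Q \<le> ?G P"
      unfolding d_d1_def by (intro cINF_lower) (auto intro: bdd_belowI[of _ 0])
    also have "?G P \<le> ?F P v"
      using v by (intro cINF_lower) (auto intro: bdd_belowI[of _ 0])
    also have "?F P v = card {i. l i \<noteq> 0}"
      unfolding form by (rule NV_diagonalized[OF symp D])
    finally show "d_d1 Q \<le> card {i. l i \<noteq> 0}" .
  }
  have "d_d1 Q \<in> ?G ` {M. invertible M}"
    unfolding d_d1_def by (intro Inf_nat_def1) (auto intro!: exI[of _ "mat 1"] simp: invertible_def)
  then obtain M where M: "invertible M" "d_d1 Q = ?G M" by blast
  have "?G M \<in> ?F M ` {N. N \<noteq> 0}"
    by (intro Inf_nat_def1) (auto intro!: exI[of _ "axis undefined 1"] simp: axis_eq_0_iff)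
  then obtain N where N: "N \<noteq> 0" "?G M = ?F M N" by blast
  have "card {i. l i \<noteq> 0} \<le> d_d1 Q" if "diagonalizes P l (pencil A N)" for P l
    unfolding trans[OF M(2) N(2)] form by (rule card_nonzero_eigenvalues_le_NV[OF symp that M(1)])
  with N(1) show "\<exists>v. v \<noteq> 0 \<and> (\<forall>P l. diagonalizes P l (pencil A v) \<longrightarrow> card {i. l i \<noteq> 0} \<le> d_d1 Q)"
    by blast
qed

section \<open>Uniform bounds on the eigenvalues\<close>

text \<open>
  The \<open>m\<close>-th elementary symmetric polynomial.  It is continuous in the eigenvalues and blind to their
  order, and it is positive exactly when at least \<open>m\<close> of its nonnegative arguments are nonzero; it thus
  replaces the \<open>m\<close>-th largest eigenvalue, whose continuity would require an ordering.
\<close>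

definition elem_sym :: "nat \<Rightarrow> ('d::finite \<Rightarrow> real) \<Rightarrow> real" where
  "elem_sym m x = (\<Sum>T\<in>{T. card T = m}. \<Prod>i\<in>T. x i)"

lemma elem_sym_scale: "elem_sym m (\<lambda>i. t * x i) = t ^ m * elem_sym m x"
  unfolding elem_sym_def sum_distrib_left by (intro sum.cong refl) (simp add: prod.distrib)

lemma elem_sym_le_prod:
  assumes "\<And>i. 0 \<le> x i"
  shows "elem_sym m x \<le> (\<Prod>i\<in>UNIV. 1 + x i)"
proof -
  have "(\<Prod>i\<in>UNIV. 1 + x i) = (\<Prod>i\<in>UNIV. x i + 1)" by (simp add: add.commute)
  also have "\<dots> = (\<Sum>T\<in>UNIV. \<Prod>i\<in>T. x i)" by (subst prod_add) auto
  also have "\<dots> \<ge> elem_sym m x"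
    unfolding elem_sym_def using assms by (intro sum_mono2) (auto intro: prod_nonneg)
  finally show ?thesis .
qed

lemma elem_sym_pos:
  assumes "\<And>i. 0 \<le> x i" and "m \<le> card {i. x i \<noteq> 0}"
  shows "0 < elem_sym m x"
proof -
  obtain T where T: "T \<subseteq> {i. x i \<noteq> 0}" "card T = m"
    using obtain_subset_with_card_n[OF assms(2)] by metis
  have "0 < (\<Prod>i\<in>T. x i)" using T(1) assms(1) by (intro prod_pos) (auto simp: less_le)
  then show ?thesis unfolding elem_sym_def
    using T(2) assms(1) by (intro sum_pos2[of _ T]) (auto intro: prod_nonneg)
qed

text \<open>
  Writing the eigenvalues as Rayleigh quotients of the columns eliminates them from the diagonalization
  condition, which becomes a closed condition on \<open>(v, P)\<close>; orthogonality bounds \<open>P\<close>.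
\<close>

lemma compact_unit_diagonalizations:
  fixes A :: "'n::finite \<Rightarrow> real ^ 'd ^ 'd"
  shows "compact {(v, P). norm v = 1 \<and> diagonalizes P (\<lambda>i. column i P \<bullet> (pencil A v *v column i P)) (pencil A v)}"
    (is "compact ?K")
proof -
  have mv: "continuous_on UNIV (\<lambda>x. f x *v g x)"
    if "continuous_on UNIV f" "continuous_on UNIV g"
    for f :: "(real ^ 'n) \<times> (real ^ 'd ^ 'd) \<Rightarrow> real ^ 'd ^ 'd" and g
    unfolding matrix_vector_mult_def using that by (intro continuous_intros)
  have p: "continuous_on UNIV (\<lambda>x. pencil A (fst x))"
    unfolding pencil_def by (intro continuous_intros)
  have c: "continuous_on UNIV (\<lambda>x. column i (snd x))" for i :: 'd
    unfolding column_def by (intro continuous_intros)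
  have K: "?K = {x. norm (fst x) = 1 \<and> (\<forall>i. norm (column i (snd x)) = 1)
      \<and> (\<forall>i j. i \<noteq> j \<longrightarrow> column i (snd x) \<bullet> column j (snd x) = 0)
      \<and> (\<forall>i. pencil A (fst x) *v column i (snd x)
          = (column i (snd x) \<bullet> (pencil A (fst x) *v column i (snd x))) *\<^sub>R column i (snd x))}"
    by (auto simp: diagonalizes_def orthogonal_matrix_orthonormal_columns orthogonal_def)
  have "closed ?K"
    unfolding K by (intro closed_Collect_conj closed_Collect_all closed_Collect_imp open_Collect_const
        closed_Collect_eq continuous_intros mv p c)
  moreover have "?K \<subseteq> cball 0 1 \<times> {P. norm P \<le> real CARD('d) * real CARD('d)}"
  proof
    fix x assume x: "x \<in> ?K"
    define v P where "v = fst x" and "P = snd x"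
    have v: "norm v = 1" and D: "diagonalizes P (\<lambda>i. column i P \<bullet> (pencil A v *v column i P)) (pencil A v)"
      using x by (auto simp: v_def P_def)
    have "\<bar>P $ j $ i\<bar> \<le> 1" for i j
    proof -
      have "\<bar>column i P $ j\<bar> \<le> norm (column i P)" by (rule component_le_norm_cart)
      then show ?thesis using D by (simp add: diagonalizes_def orthogonal_matrix_orthonormal_columns column_def)
    qed
    then have "norm (P $ j) \<le> real CARD('d)" for j
      using norm_le_l1_cart[of "P $ j"] sum_bounded_above[of UNIV "\<lambda>i. \<bar>P $ j $ i\<bar>" 1] by simp
    moreover have "norm P \<le> (\<Sum>j\<in>UNIV. norm (P $ j))" unfolding norm_vec_def by (rule L2_set_le_sum) simp
    ultimately have "norm P \<le> real CARD('d) * real CARD('d)"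
      using sum_bounded_above[of UNIV "\<lambda>j. norm (P $ j)" "real CARD('d)"] by (fastforce intro: order_trans)
    then show "x \<in> cball 0 1 \<times> {P. norm P \<le> real CARD('d) * real CARD('d)}"
      using v by (simp add: v_def P_def mem_Times_iff)
  qed
  then have "bounded ?K"
    by (rule bounded_subset[rotated]) (intro bounded_Times bounded_cball, auto simp: bounded_iff)
  ultimately show ?thesis by (simp add: compact_eq_bounded_closed)
qed

text \<open>
  A positive continuous function on a compact set has a positive minimum.
\<close>

lemma elem_sym_eigenvalues_bounded_below:
  fixes A :: "'n::finite \<Rightarrow> real ^ 'd ^ 'd"
  assumes rank: "\<And>v P l. v \<noteq> 0 \<Longrightarrow> diagonalizes P l (pencil A v) \<Longrightarrow> m \<le> card {i. l i \<noteq> 0}"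
  shows "\<exists>c>0. \<forall>v P l. norm v = 1 \<longrightarrow> diagonalizes P l (pencil A v) \<longrightarrow> c \<le> elem_sym m (\<lambda>i. (l i)\<^sup>2)"
proof -
  define L :: "(real ^ 'n) \<times> (real ^ 'd ^ 'd) \<Rightarrow> 'd \<Rightarrow> real" where "L x i = column i (snd x) \<bullet> (pencil A (fst x) *v column i (snd x))" for x i
  define K where "K = {x. norm (fst x) = 1 \<and> diagonalizes (snd x) (L x) (pencil A (fst x))}"
  have L: "L x = (\<lambda>i. column i (snd x) \<bullet> (pencil A (fst x) *v column i (snd x)))" for x
    by (rule ext) (rule L_def)
  have comp: "compact K"
    using compact_unit_diagonalizations[of A] by (simp only: K_def L case_prod_unfold)
  have cont: "continuous_on K (\<lambda>x. elem_sym m (\<lambda>i. (L x i)\<^sup>2))"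
    unfolding elem_sym_def L_def pencil_def matrix_vector_mult_def column_def
    by (intro continuous_intros)
  have pos: "0 < elem_sym m (\<lambda>i. (L x i)\<^sup>2)" if "x \<in> K" for x
  proof -
    have "fst x \<noteq> 0" using that by (auto simp: K_def)
    then have "m \<le> card {i. L x i \<noteq> 0}" using that by (intro rank) (auto simp: K_def)
    then show ?thesis by (intro elem_sym_pos) auto
  qed
  have inK: "(v, P) \<in> K \<and> L (v, P) = l" if "norm v = 1" "diagonalizes P l (pencil A v)" for v P l
  proof -
    have "L (v, P) = l" using diagonalizes_eigenvalue[OF that(2)] by (auto simp: L_def)
    then show ?thesis using that by (simp add: K_def)
  qed
  show ?thesis
  proof (cases "K = {}")
    case True
    then show ?thesis using inK by (intro exI[of _ 1]) auto
  next
    case False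
    then obtain x where x: "x \<in> K" "\<And>y. y \<in> K \<Longrightarrow> elem_sym m (\<lambda>i. (L x i)\<^sup>2) \<le> elem_sym m (\<lambda>i. (L y i)\<^sup>2)"
      using continuous_attains_inf[OF comp _ cont] by blast
    then show ?thesis using pos inK by (intro exI[of _ "elem_sym m (\<lambda>i. (L x i)\<^sup>2)"]) blast
  qed
qed

text \<open>
  For \<open>norm v > 1\<close> the previous bound at \<open>v / norm v\<close> is scaled by homogeneity and compared with the
  product through \<open>elem_sym_le_prod\<close>.  For \<open>norm v \<le> 1\<close> the product is at least \<open>1\<close>, which suffices.
\<close>

lemma prod_eigenvalues_lower_bound:
  fixes A :: "'n::finite \<Rightarrow> real ^ 'd ^ 'd"
  assumes rank: "\<And>v P l. v \<noteq> 0 \<Longrightarrow> diagonalizes P l (pencil A v) \<Longrightarrow> m \<le> card {i. l i \<noteq> 0}"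
  shows "\<exists>c>0. \<forall>v P l. diagonalizes P l (pencil A v) \<longrightarrow> c * (1 + (norm v)\<^sup>2) ^ m \<le> (\<Prod>i\<in>UNIV. 1 + 4 * (l i)\<^sup>2)"
proof -
  have "\<exists>c>0. \<forall>v P l. norm v = 1 \<longrightarrow> diagonalizes P l (pencil A v) \<longrightarrow> c \<le> elem_sym m (\<lambda>i. (l i)\<^sup>2)"
    by (rule elem_sym_eigenvalues_bounded_below) (rule rank)
  then obtain c where c: "c > 0"
    "\<And>v P l. norm v = 1 \<Longrightarrow> diagonalizes P l (pencil A v) \<Longrightarrow> c \<le> elem_sym m (\<lambda>i. (l i)\<^sup>2)"
    by blast
  \<comment> \<open>In either case \<open>1 + (norm v)\<^sup>2\<close> is at most twice the larger of \<open>1\<close> and \<open>(norm v)\<^sup>2\<close>.\<close>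
  define c' where "c' = min 1 c / 2 ^ m"
  have "c' * (1 + (norm v)\<^sup>2) ^ m \<le> (\<Prod>i\<in>UNIV. 1 + 4 * (l i)\<^sup>2)" if D: "diagonalizes P l (pencil A v)" for v P l
  proof (cases "norm v \<le> 1")
    case True
    have "(1 + (norm v)\<^sup>2) ^ m \<le> 2 ^ m" using True by (intro power_mono) (auto simp: power_le_one)
    then have "c' * (1 + (norm v)\<^sup>2) ^ m \<le> c' * 2 ^ m" using c(1) by (intro mult_left_mono) (auto simp: c'_def)
    also have "\<dots> \<le> 1" by (simp add: c'_def)
    also have "\<dots> \<le> (\<Prod>i\<in>UNIV. 1 + 4 * (l i)\<^sup>2)" by (intro prod_ge_1) auto
    finally show ?thesis .
  next
    case False
    then have nv: "norm v > 1" by simp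
    define w where "w = (1 / norm v) *\<^sub>R v"
    have w: "norm w = 1" using nv by (auto simp: w_def)
    have "diagonalizes P (\<lambda>i. (1 / norm v) * l i) (pencil A w)"
      unfolding w_def pencil_scaleR by (rule diagonalizes_scaleR[OF D])
    then have "c \<le> elem_sym m (\<lambda>i. ((1 / norm v) * l i)\<^sup>2)" by (rule c(2)[OF w])
    also have "(\<lambda>i. ((1 / norm v) * l i)\<^sup>2) = (\<lambda>i. (1 / (4 * (norm v)\<^sup>2)) * (4 * (l i)\<^sup>2))"
      by (simp add: power_divide)
    also have "elem_sym m \<dots> = (1 / (4 * (norm v)\<^sup>2)) ^ m * elem_sym m (\<lambda>i. 4 * (l i)\<^sup>2)"
      by (rule elem_sym_scale)
    finally have "c \<le> elem_sym m (\<lambda>i. 4 * (l i)\<^sup>2) / (4 * (norm v)\<^sup>2) ^ m"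
      by (simp add: power_one_over field_simps)
    moreover have "0 < (4 * (norm v)\<^sup>2) ^ m" using nv by (intro zero_less_power) auto
    ultimately have "c * (4 * (norm v)\<^sup>2) ^ m \<le> elem_sym m (\<lambda>i. 4 * (l i)\<^sup>2)"
      by (simp only: pos_le_divide_eq)
    also have "\<dots> \<le> (\<Prod>i\<in>UNIV. 1 + 4 * (l i)\<^sup>2)" by (rule elem_sym_le_prod) simp
    finally have 1: "c * (4 * (norm v)\<^sup>2) ^ m \<le> (\<Prod>i\<in>UNIV. 1 + 4 * (l i)\<^sup>2)" .
    have "1 \<le> (norm v)\<^sup>2" using nv by (simp add: one_le_power)
    then have "(1 + (norm v)\<^sup>2) ^ m \<le> (2 * (4 * (norm v)\<^sup>2)) ^ m" by (intro power_mono) auto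
    then have "c' * (1 + (norm v)\<^sup>2) ^ m \<le> c' * (2 * (4 * (norm v)\<^sup>2)) ^ m"
      using c(1) by (intro mult_left_mono) (auto simp: c'_def)
    also have "\<dots> = min 1 c * (4 * (norm v)\<^sup>2) ^ m" unfolding c'_def power_mult_distrib[of 2] by simp
    also have "\<dots> \<le> c * (4 * (norm v)\<^sup>2) ^ m" by (intro mult_right_mono) auto
    finally show ?thesis using 1 by simp
  qed
  moreover have "c' > 0" using c(1) by (simp add: c'_def)
  ultimately show ?thesis by blast
qed

lemma eigenvalues_upper_bound:
  fixes A :: "'n::finite \<Rightarrow> real ^ 'd ^ 'd"
  shows "\<exists>L\<ge>1. \<forall>v P l i. diagonalizes P l (pencil A v) \<longrightarrow> 1 + 4 * (l i)\<^sup>2 \<le> L * (1 + (norm v)\<^sup>2)"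
proof -
  have "bounded_linear ((*v) (A k))" for k
    by (simp add: linear_conv_bounded_linear[symmetric])
  then have "\<forall>k. \<exists>b. \<forall>x. norm (A k *v x) \<le> norm x * b"
    by (intro allI bounded_linear.bounded)
  from choice[OF this] have "\<exists>b. \<forall>k x. norm (A k *v x) \<le> norm x * b k" .
  then obtain b where b: "\<And>k x. norm (A k *v x) \<le> norm x * b k" by blast
  define K where "K = (\<Sum>k\<in>UNIV. b k)"
  have "1 + 4 * (l i)\<^sup>2 \<le> (1 + 4 * K\<^sup>2) * (1 + (norm v)\<^sup>2)" if D: "diagonalizes P l (pencil A v)" for v P l i
  proof -
    have n1: "norm (column i P) = 1" using D by (simp add: diagonalizes_def orthogonal_matrix_orthonormal_columns)
    have "\<bar>l i\<bar> \<le> norm (column i P) * norm (pencil A v *v column i P)"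
      unfolding diagonalizes_eigenvalue[OF D] by (rule Cauchy_Schwarz_ineq2)
    also have "\<dots> \<le> (\<Sum>k\<in>UNIV. norm (v $ k *\<^sub>R (A k *v column i P)))"
      unfolding n1 pencil_mult by (simp only: mult_1) (rule norm_sum)
    also have "\<dots> \<le> (\<Sum>k\<in>UNIV. norm v * b k)"
      using b[of _ "column i P"] n1 by (intro sum_mono) (auto intro!: mult_mono component_le_norm_cart)
    finally have "\<bar>l i\<bar> \<le> norm v * K" by (simp add: K_def sum_distrib_left)
    then have "\<bar>l i\<bar> \<le> \<bar>norm v * K\<bar>" by linarith
    then have "(l i)\<^sup>2 \<le> (norm v * K)\<^sup>2" by (simp only: abs_le_square_iff)
    moreover have "(1 + 4 * K\<^sup>2) * (1 + (norm v)\<^sup>2) = 1 + 4 * (norm v * K)\<^sup>2 + (4 * K\<^sup>2 + (norm v)\<^sup>2)"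
      by (simp add: power_mult_distrib algebra_simps)
    moreover have "0 \<le> 4 * K\<^sup>2 + (norm v)\<^sup>2" by simp
    ultimately show ?thesis by linarith
  qed
  then show ?thesis by (intro exI[of _ "1 + 4 * K\<^sup>2"]) auto
qed

section \<open>Decay of the extension operator\<close>

text \<open>
  The fourth power clears the square root from the factors \<open>sqrt (1 + 4 * (l i)\<^sup>2)\<close> of the squared
  modulus.
\<close>

lemma norm_ext_op:
  fixes Q :: "real ^ 'd \<Rightarrow> real ^ 'n" and A :: "'n \<Rightarrow> real ^ 'd ^ 'd"
  assumes Q: "\<And>k \<xi>. Q \<xi> $ k = \<xi> \<bullet> (A k *v \<xi>)" and D: "diagonalizes P l (pencil A v)"
  shows "norm (ext_op Q (\<lambda>_. 1) (u, v)) ^ 4 =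
    (2 * pi) ^ (2 * CARD('d)) / (\<Prod>i\<in>UNIV. 1 + 4 * (l i)\<^sup>2)
      * exp (- (\<Sum>i\<in>UNIV. 2 * ((transpose P *v u) $ i)\<^sup>2 / (1 + 4 * (l i)\<^sup>2)))"
proof -
  let ?q = "\<lambda>\<xi>. Q \<xi> \<bullet> v"
  define a where "a = transpose P *v u"
  have P: "orthogonal_matrix P" using D by (simp add: diagonalizes_def)
  have form: "?q (P *v \<xi>) = (\<Sum>i\<in>UNIV. l i * (\<xi> $ i)\<^sup>2)" for \<xi>
    by (simp only: pencil_form[of Q A, OF Q] diagonalizes_form[OF D])
  have meas: "?q \<in> borel_measurable borel"
    unfolding pencil_form[of Q A, OF Q] matrix_vector_mult_def
    by (intro borel_measurable_continuous_onI continuous_intros)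
  have "ext_op Q (\<lambda>_. 1) (u, v)
      = (LINT \<xi>|lborel. exp (\<i> * of_real (u \<bullet> \<xi> + ?q \<xi>)) * of_real (exp (- (norm \<xi>)\<^sup>2 / 2)))"
    by (simp add: ext_op_def inner_commute[of v])
  then have "(norm (ext_op Q (\<lambda>_. 1) (u, v)))\<^sup>2
      = (\<Prod>i\<in>UNIV. 2 * pi / sqrt (1 + 4 * (l i)\<^sup>2) * exp (- ((a $ i)\<^sup>2 / (1 + 4 * (l i)\<^sup>2))))"
    unfolding a_def by (simp only: norm_gaussian_oscillatory_integral[where q = ?q and l = l, OF P form meas])
  moreover have "norm (ext_op Q (\<lambda>_. 1) (u, v)) ^ 4 = ((norm (ext_op Q (\<lambda>_. 1) (u, v)))\<^sup>2)\<^sup>2"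
    by (simp flip: power_mult)
  ultimately have "norm (ext_op Q (\<lambda>_. 1) (u, v)) ^ 4
      = (\<Prod>i\<in>UNIV. (2 * pi / sqrt (1 + 4 * (l i)\<^sup>2) * exp (- ((a $ i)\<^sup>2 / (1 + 4 * (l i)\<^sup>2))))\<^sup>2)"
    by (simp only: prod_power_distrib)
  also have "\<dots> = (\<Prod>i\<in>UNIV. (2 * pi)\<^sup>2 / (1 + 4 * (l i)\<^sup>2) * exp (- (2 * (a $ i)\<^sup>2 / (1 + 4 * (l i)\<^sup>2))))"
    by (intro prod.cong refl) (simp add: power_mult_distrib power_divide exp_double[symmetric])
  also have "\<dots> = (2 * pi) ^ (2 * CARD('d)) / (\<Prod>i\<in>UNIV. 1 + 4 * (l i)\<^sup>2)
      * exp (- (\<Sum>i\<in>UNIV. 2 * (a $ i)\<^sup>2 / (1 + 4 * (l i)\<^sup>2)))"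
    by (simp add: prod.distrib prod_dividef exp_sum sum_negf[symmetric] power_mult)
  finally show ?thesis unfolding a_def .
qed

text \<open>
  The trade of exponential for polynomial decay, from \<open>(1 + y / m) ^ m \<le> exp y\<close>.
\<close>

lemma power_le_exp: "0 \<le> y \<Longrightarrow> (1 + y) ^ m \<le> real m ^ m * exp (y :: real)"
proof (cases "m = 0")
  case False
  assume y: "0 \<le> y"
  have "(1 + y) ^ m \<le> (real m * (1 + y / real m)) ^ m"
    using y False by (intro power_mono) (auto simp: field_simps)
  also have "\<dots> \<le> real m ^ m * exp y"
    unfolding power_mult_distrib using y False exp_ge_one_plus_x_over_n_power_n[of m y]
    by (intro mult_left_mono) auto
  finally show ?thesis .
qed simp

text \<open>
  With \<open>r = (norm v)\<^sup>2\<close>, \<open>s = (norm u)\<^sup>2\<close> and \<open>y = s / (L * (1 + r))\<close>, the eigenvalue bounds control the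
  fourth power of the modulus by a multiple of \<open>exp (- y) / (1 + r) ^ m\<close>, hence of
  \<open>((1 + r) * (1 + y)) ^ (- m)\<close>.  The product \<open>(1 + r) * (1 + y)\<close> is \<open>1 + r + s / L\<close>, which is comparable
  to \<open>(1 + norm x)\<^sup>2\<close>.
\<close>

lemma ext_op_decay:
  fixes Q :: "real ^ 'd \<Rightarrow> real ^ 'n" and A :: "'n \<Rightarrow> real ^ 'd ^ 'd"
  assumes sym: "\<And>k. transpose (A k) = A k" and Q: "\<And>k \<xi>. Q \<xi> $ k = \<xi> \<bullet> (A k *v \<xi>)"
  shows "\<exists>C. \<forall>x. norm (ext_op Q (\<lambda>_. 1) x) \<le> C * (1 + norm x) powr (- (real (d_d1 Q) / 2))"
proof -
  define m where "m = d_d1 Q"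
  have "\<exists>c>0. \<forall>v P l. diagonalizes P l (pencil A v) \<longrightarrow> c * (1 + (norm v)\<^sup>2) ^ m \<le> (\<Prod>i\<in>UNIV. 1 + 4 * (l i)\<^sup>2)"
    unfolding m_def by (rule prod_eigenvalues_lower_bound) (rule d_d1_le_rank[OF sym Q])
  then obtain c where c: "c > 0"
    "\<And>v P l. diagonalizes P l (pencil A v) \<Longrightarrow> c * (1 + (norm v)\<^sup>2) ^ m \<le> (\<Prod>i\<in>UNIV. 1 + 4 * (l i)\<^sup>2)"
    by blast
  obtain L where L: "L \<ge> 1"
    "\<And>v P l i. diagonalizes P l (pencil A v) \<Longrightarrow> 1 + 4 * (l i)\<^sup>2 \<le> L * (1 + (norm v)\<^sup>2)"
    using eigenvalues_upper_bound[of A] by blast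
  define C where "C = (2 * pi) ^ (2 * CARD('d)) * real m ^ m / c * (2 * L) ^ m"
  have C0: "0 \<le> C" using c(1) L(1) by (auto simp: C_def)
  have main: "norm (ext_op Q (\<lambda>_. 1) x) ^ 4 * (1 + norm x) ^ (2 * m) \<le> C" for x
  proof -
    obtain u v where x: "x = (u, v)" by (cases x)
    obtain P l where D: "diagonalizes P l (pencil A v)"
      using symmetric_diagonalizable[OF transpose_pencil[of A v, OF sym]] by blast
    have P: "orthogonal_matrix (transpose P)" using D by (simp add: diagonalizes_def)
    define a where "a = transpose P *v u"
    define r where "r = (norm v)\<^sup>2"
    define s where "s = (norm u)\<^sup>2"
    have rs: "0 \<le> r" "0 \<le> s" by (auto simp: r_def s_def)
    define y where "y = s / (L * (1 + r))"
    have y0: "0 \<le> y" using rs L(1) by (simp add: y_def)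
    let ?G = "\<Prod>i\<in>UNIV. 1 + 4 * (l i)\<^sup>2"
    let ?E = "\<Sum>i\<in>UNIV. 2 * (a $ i)\<^sup>2 / (1 + 4 * (l i)\<^sup>2)"
    have "s = (\<Sum>i\<in>UNIV. (a $ i)\<^sup>2)"
    proof -
      have "s = a \<bullet> a" unfolding a_def s_def orthogonal_matrix_inner[OF P] by (simp add: dot_square_norm)
      then show ?thesis by (simp add: inner_vec_def power2_eq_square)
    qed
    then have "y = (\<Sum>i\<in>UNIV. (a $ i)\<^sup>2 / (L * (1 + r)))" by (simp add: y_def sum_divide_distrib)
    also have "\<dots> \<le> ?E"
    proof (intro sum_mono)
      fix i
      have "1 + 4 * (l i)\<^sup>2 \<le> L * (1 + r)" unfolding r_def by (rule L(2)[OF D])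
      moreover have "0 < L" "0 < 1 + r" "0 < 1 + 4 * (l i)\<^sup>2"
        using L(1) rs by (simp_all add: add_pos_nonneg)
      ultimately have "(a $ i)\<^sup>2 / (L * (1 + r)) \<le> (a $ i)\<^sup>2 / (1 + 4 * (l i)\<^sup>2)"
        by (intro divide_left_mono mult_pos_pos) auto
      also have "\<dots> \<le> 2 * (a $ i)\<^sup>2 / (1 + 4 * (l i)\<^sup>2)" by (intro divide_right_mono) auto
      finally show "(a $ i)\<^sup>2 / (L * (1 + r)) \<le> 2 * (a $ i)\<^sup>2 / (1 + 4 * (l i)\<^sup>2)" .
    qed
    finally have yE: "exp (- ?E) \<le> exp (- y)" by simp
    have G: "c * (1 + r) ^ m \<le> ?G" unfolding r_def by (rule c(2)[OF D])
    have r1: "0 < (1 + r) ^ m" using rs by simp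
    have "norm (ext_op Q (\<lambda>_. 1) x) ^ 4 = (2 * pi) ^ (2 * CARD('d)) / ?G * exp (- ?E)"
      unfolding x a_def by (rule norm_ext_op[OF Q D])
    also have "\<dots> \<le> (2 * pi) ^ (2 * CARD('d)) / (c * (1 + r) ^ m) * exp (- y)"
      using G yE c(1) r1 by (intro mult_mono divide_left_mono) (auto intro!: mult_pos_pos prod_pos add_pos_nonneg)
    finally have N: "norm (ext_op Q (\<lambda>_. 1) x) ^ 4 \<le> (2 * pi) ^ (2 * CARD('d)) / (c * (1 + r) ^ m) * exp (- y)" .
    have "(1 + norm x) ^ 2 \<le> 2 * (1 + r + s)"
    proof -
      have "(norm x)\<^sup>2 = r + s" by (simp add: x norm_Pair r_def s_def)
      moreover have "0 \<le> (1 - norm x)\<^sup>2" by simp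
      ultimately show ?thesis by (simp add: power2_eq_square algebra_simps)
    qed
    also have "1 + r + s \<le> L * ((1 + r) * (1 + y))"
    proof -
      have "L * ((1 + r) * (1 + y)) = L * (1 + r) + s" 
      proof -
        have "L * (1 + r) * y = s" using rs L(1) by (simp add: y_def add_pos_nonneg)
        then show ?thesis by (simp add: algebra_simps)
      qed
      moreover have "1 * (1 + r) \<le> L * (1 + r)" using L(1) rs by (intro mult_right_mono) auto
      ultimately show ?thesis by simp
    qed
    finally have "(1 + norm x) ^ 2 \<le> 2 * L * ((1 + r) * (1 + y))" by simp
    then have "((1 + norm x) ^ 2) ^ m \<le> (2 * L * ((1 + r) * (1 + y))) ^ m" by (intro power_mono) auto
    then have X: "(1 + norm x) ^ (2 * m) \<le> (2 * L) ^ m * (1 + r) ^ m * (1 + y) ^ m"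
      by (simp add: power_mult power_mult_distrib mult.assoc)
    have Y: "(1 + y) ^ m * exp (- y) \<le> real m ^ m"
      using power_le_exp[OF y0, of m] by (simp add: exp_minus field_simps)
    have "norm (ext_op Q (\<lambda>_. 1) x) ^ 4 * (1 + norm x) ^ (2 * m)
        \<le> ((2 * pi) ^ (2 * CARD('d)) / (c * (1 + r) ^ m) * exp (- y)) * ((2 * L) ^ m * (1 + r) ^ m * (1 + y) ^ m)"
      using N X by (intro mult_mono order_trans[OF _ N]) auto
    also have "\<dots> = (2 * pi) ^ (2 * CARD('d)) / c * (2 * L) ^ m * ((1 + y) ^ m * exp (- y))"
      using c(1) r1 rs by (simp add: field_simps)
    also have "\<dots> \<le> (2 * pi) ^ (2 * CARD('d)) / c * (2 * L) ^ m * real m ^ m"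
      using Y c(1) L(1) by (intro mult_left_mono) auto
    also have "\<dots> = C" by (simp add: C_def)
    finally show ?thesis .
  qed
  have "norm (ext_op Q (\<lambda>_. 1) x) \<le> (1 + C) * (1 + norm x) powr (- (real m / 2))" for x
  proof -
    define z where "z = norm (ext_op Q (\<lambda>_. 1) x) * (1 + norm x) powr (real m / 2)"
    have n: "1 + norm x > 0" by (simp add: add_pos_nonneg)
    have "((1 + norm x) powr (real m / 2)) ^ 4 = (1 + norm x) ^ (2 * m)"
      using n by (simp add: powr_realpow[symmetric] powr_powr flip: powr_numeral)
    then have "z ^ 4 \<le> C" using main[of x] by (simp add: z_def power_mult_distrib)
    \<comment> \<open>The bound \<open>1 + C\<close> avoids taking a fourth root of \<open>C\<close>.\<close>
    also have "C \<le> (1 + C) ^ 4" using C0 self_le_power[of "1 + C" 4] by simp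
    finally have "z \<le> 1 + C" using C0 by (intro power_le_imp_le_base[of z 3]) (auto simp: numeral_eq_Suc)
    then show ?thesis using n by (simp add: z_def powr_minus field_simps)
  qed
  then show ?thesis unfolding m_def by blast
qed

text \<open>
  On the ray \<open>(0, t *\<^sub>R v)\<close>, with \<open>v\<close> a direction of least rank \<open>m\<close>, at most \<open>m\<close> eigenvalues grow with
  \<open>t\<close>, so the fourth power of the modulus is at least a multiple of \<open>t ^ (- 2 m)\<close>.  A bound with exponent
  \<open>\<gamma>\<close> would then keep \<open>t powr (4 * \<gamma> - 2 * m)\<close> bounded for \<open>t \<ge> 1\<close>.
\<close>

lemma ext_op_no_faster_decay:
  fixes Q :: "real ^ 'd \<Rightarrow> real ^ 'n" and A :: "'n \<Rightarrow> real ^ 'd ^ 'd"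
  assumes sym: "\<And>k. transpose (A k) = A k" and Q: "\<And>k \<xi>. Q \<xi> $ k = \<xi> \<bullet> (A k *v \<xi>)"
    and \<gamma>: "\<gamma> > real (d_d1 Q) / 2"
    and C: "\<And>x. norm (ext_op Q (\<lambda>_. 1) x) \<le> C * (1 + norm x) powr (- \<gamma>)"
  shows False
proof -
  define m where "m = d_d1 Q"
  obtain v where v: "v \<noteq> 0" "\<And>P l. diagonalizes P l (pencil A v) \<Longrightarrow> card {i. l i \<noteq> 0} \<le> m"
    unfolding m_def using d_d1_attained[of A Q, OF sym Q] by blast
  obtain P l where D: "diagonalizes P l (pencil A v)"
    using symmetric_diagonalizable[OF transpose_pencil[of A v, OF sym]] by blast
  define L where "L = (\<Sum>i\<in>UNIV. (l i)\<^sup>2)"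
  have lL: "(l i)\<^sup>2 \<le> L" for i unfolding L_def by (rule member_le_sum) auto
  have L0: "0 \<le> L" by (simp add: L_def sum_nonneg)
  have g0: "\<gamma> > 0" using \<gamma> by (smt (verit) divide_nonneg_pos of_nat_0_le_iff)
  define \<delta> where "\<delta> = 4 * \<gamma> - 2 * real m"
  have \<delta>: "\<delta> > 0" using \<gamma> by (simp add: \<delta>_def m_def)
  define B where "B = C ^ 4 * norm v powr (- (4 * \<gamma>)) * (1 + 4 * L) ^ m / (2 * pi) ^ (2 * CARD('d))"
  have bound: "t powr \<delta> \<le> B" if t: "t \<ge> 1" for t
  proof -
    let ?E = "ext_op Q (\<lambda>_. 1) (0, t *\<^sub>R v)"
    let ?G = "\<Prod>i\<in>UNIV. 1 + 4 * (t * l i)\<^sup>2"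
    have D': "diagonalizes P (\<lambda>i. t * l i) (pencil A (t *\<^sub>R v))"
      unfolding pencil_scaleR by (rule diagonalizes_scaleR[OF D])
    have E: "norm ?E ^ 4 = (2 * pi) ^ (2 * CARD('d)) / ?G"
      using norm_ext_op[OF Q D', of 0] by simp
    have t2: "1 \<le> t\<^sup>2" using t by (simp add: one_le_power)
    have "?G = (\<Prod>i\<in>{i. l i \<noteq> 0}. 1 + 4 * (t * l i)\<^sup>2)"
      by (rule prod.mono_neutral_right) auto
    also have "\<dots> \<le> (\<Prod>i\<in>{i. l i \<noteq> 0}. (1 + 4 * L) * t\<^sup>2)"
    proof (intro prod_mono conjI)
      fix i
      have "t\<^sup>2 * (l i)\<^sup>2 \<le> t\<^sup>2 * L" using lL by (intro mult_left_mono) auto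
      then show "1 + 4 * (t * l i)\<^sup>2 \<le> (1 + 4 * L) * t\<^sup>2" using t2 by (simp add: power_mult_distrib algebra_simps)
    qed simp
    also have "\<dots> = ((1 + 4 * L) * t\<^sup>2) ^ card {i. l i \<noteq> 0}" by simp
    also have "\<dots> \<le> ((1 + 4 * L) * t\<^sup>2) ^ m"
    proof (rule power_increasing[OF v(2)[OF D]])
      have "1 * 1 \<le> (1 + 4 * L) * t\<^sup>2" using L0 t2 by (intro mult_mono) auto
      then show "1 \<le> (1 + 4 * L) * t\<^sup>2" by simp
    qed
    finally have G: "?G \<le> (1 + 4 * L) ^ m * t ^ (2 * m)" by (simp add: power_mult_distrib power_mult)
    have Gpos: "0 < ?G" by (intro prod_pos) (auto intro: add_pos_nonneg)
    have tv: "t * norm v > 0" using t v(1) by simp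
    have "0 \<le> C * (1 + norm (0 :: real ^ 'd, t *\<^sub>R v)) powr (- \<gamma>)"
      by (rule order_trans[OF norm_ge_zero C])
    moreover have "0 < (1 + norm (0 :: real ^ 'd, t *\<^sub>R v)) powr (- \<gamma>)"
    proof -
      have "1 + norm (0 :: real ^ 'd, t *\<^sub>R v) \<noteq> 0"
        using norm_ge_zero[of "(0 :: real ^ 'd, t *\<^sub>R v)"] by linarith
      then show ?thesis using powr_gt_zero by blast
    qed
    ultimately have C0: "0 \<le> C" by (meson mult_neg_pos not_le)
    have "norm ?E \<le> C * (1 + t * norm v) powr (- \<gamma>)"
      using C[of "(0, t *\<^sub>R v)"] t by (simp add: norm_Pair)
    also have "\<dots> \<le> C * (t * norm v) powr (- \<gamma>)"
      using g0 tv C0 by (intro mult_left_mono powr_mono2') auto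
    finally have "norm ?E ^ 4 \<le> (C * (t * norm v) powr (- \<gamma>)) ^ 4" by (intro power_mono) auto
    also have "\<dots> = C ^ 4 * (t powr (- (4 * \<gamma>)) * norm v powr (- (4 * \<gamma>)))"
    proof -
      have "((t * norm v) powr (- \<gamma>)) ^ 4 = (t * norm v) powr (- (4 * \<gamma>))"
        using tv by (simp add: powr_realpow[symmetric] powr_powr mult.commute flip: powr_numeral)
      then show ?thesis using t by (simp add: power_mult_distrib powr_mult)
    qed
    finally have "(2 * pi) ^ (2 * CARD('d)) / ?G \<le> C ^ 4 * (t powr (- (4 * \<gamma>)) * norm v powr (- (4 * \<gamma>)))"
      unfolding E .
    then have "(2 * pi) ^ (2 * CARD('d)) \<le> C ^ 4 * (t powr (- (4 * \<gamma>)) * norm v powr (- (4 * \<gamma>))) * ?G"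
      using Gpos by (simp add: field_simps)
    also have "\<dots> \<le> C ^ 4 * (t powr (- (4 * \<gamma>)) * norm v powr (- (4 * \<gamma>))) * ((1 + 4 * L) ^ m * t ^ (2 * m))"
      using G by (intro mult_left_mono) auto
    also have "\<dots> = (2 * pi) ^ (2 * CARD('d)) * B * (t powr (- (4 * \<gamma>)) * t ^ (2 * m))"
      by (simp add: B_def)
    also have "t powr (- (4 * \<gamma>)) * t ^ (2 * m) = t powr (- \<delta>)"
      using t by (simp add: \<delta>_def powr_realpow[symmetric] powr_add[symmetric])
    finally have "1 \<le> B * t powr (- \<delta>)" by simp
    then show ?thesis using t by (simp add: powr_minus field_simps)
  qed
  have "B \<ge> 1" using bound[of 1] by simp
  \<comment> \<open>The point \<open>t\<close> at which \<open>t powr \<delta> = B + 1\<close>.\<close>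
  then have "((B + 1) powr (1 / \<delta>)) powr \<delta> \<le> B" using \<delta> by (intro bound ge_one_powr_ge_zero) auto
  then show False using \<delta> \<open>B \<ge> 1\<close> by (simp add: powr_powr)
qed

theorem theorem3p1:
  fixes Q :: "real ^ 'd \<Rightarrow> real ^ 'n"
  assumes "\<And>k. quadratic_form (\<lambda>\<xi>. Q \<xi> $ k)"
  shows "(\<exists>C. \<forall>x. norm (ext_op Q (\<lambda>_. 1) x) \<le> C * (1 + norm x) powr (- (real (d_d1 Q) / 2)))
    \<and> (\<forall>\<gamma> > real (d_d1 Q) / 2.
          \<not> (\<exists>C. \<forall>x. norm (ext_op Q (\<lambda>_. 1) x) \<le> C * (1 + norm x) powr (- \<gamma>)))"
proof -
  have "\<forall>k. \<exists>A. transpose A = A \<and> (\<forall>\<xi>. Q \<xi> $ k = \<xi> \<bullet> (A *v \<xi>))"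
    using quadratic_form_symmetric[OF assms] by blast
  from choice[OF this] obtain A :: "'n \<Rightarrow> real ^ 'd ^ 'd"
    where "\<And>k. transpose (A k) = A k" "\<And>k \<xi>. Q \<xi> $ k = \<xi> \<bullet> (A k *v \<xi>)" by blast
  then show ?thesis
    using ext_op_decay[of A Q] ext_op_no_faster_decay[of A Q] by blast
qed

end
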